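(* Let $q=p^e$ be a prime power and let $\mathbb U_{S,\mathcal D}$ be an affine $\mathrm{SL}(2,q)$-unital with a parallelism $\pi$ such that for every $h\in\mathrm{SL}(2,q)$ the right multiplication $x\mapsto xh$ maps $\pi$ to itself (i.e. maps parallel classes to parallel classes). Then $\pi\in\{\flat,\natural\}$.
   Context: Affine $\mathrm{SL}(2,q)$-unital: let $S\le\mathrm{SL}(2,q)$ be a subgroup of order $q+1$, let $\mathfrak P$ be the set of Sylow $p$-subgroups of $\mathrm{SL}(2,q)$, and let $\mathcal D$ be a collection of subsets of $\mathrm{SL}(2,q)$, each containing the identity $\mathbb 1$ and of size $q+1$, such that (Q) for each $D\in\mathcal D$ the set $D^*=\{xy^{-1}\mid x,y\in D,\ x\ne y\}$ has $q(q+1)$ elements, and (P) the sets $S\smallsetminus\{\mathbb 1\}$, $T\smallsetminus\{\mathbb 1\}$ ($T\in\mathfrak P$) and $D^*$ ($D\in\mathcal D$) partition $\mathrm{SL}(2,q)\smallsetminus\{\mathbb 1\}$. $\mathbb U_{S,\mathcal D}$ has point set $\mathrm{SL}(2,q)$, blocks $Sg$, $Tg$ ($T\in\mathfrak P$), $Dg$ ($D\in\mathcal D$), $g\in\mathrm{SL}(2,q)$, incidence containment. The short blocks are the blocks $Tg$ ($T\in\mathfrak P$, $g\in\mathrm{SL}(2,q)$), which have $q$ points. A parallelism is a partition of the set of short blocks into $q+1$ classes of $q^2-1$ pairwise disjoint blocks. $\flat=\{\{Tg\mid g\in\mathrm{SL}(2,q)\}\mid T\in\mathfrak P\}$ and $\natural=\{\{gT\mid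 g\in\mathrm{SL}(2,q)\}\mid T\in\mathfrak P\}$. *)

theory Defs
  imports "HOL-Analysis.Determinants" "HOL-Algebra.Coset" "HOL-Library.Disjoint_Sets"
    "HOL-Computational_Algebra.Primes"
begin

text \<open>A finite field of order \<open>q\<close> is a type \<open>'a :: {field, finite}\<close> with \<open>q = CARD('a)\<close>.\<close>

definition SL2 :: "('a::{field,finite}^2^2) monoid" where
  "SL2 = \<lparr>carrier = {A. det A = 1}, mult = (**), one = mat 1\<rparr>"

lemma group_SL2: "group (SL2 :: ('a::{field,finite}^2^2) monoid)"
proof (rule groupI)
  fix A :: "'a^2^2"
  assume "A \<in> carrier SL2"
  then have A: "det A = 1" by (simp add: SL2_def)
  then have "invertible A" by (simp add: invertible_det_nz)
  then obtain B where B: "A ** B = mat 1" "B ** A = mat 1"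
    by (auto simp: invertible_def)
  have "det (B ** A) = 1" unfolding B(2) by simp
  then have "det B = 1" using A by (simp add: det_mul)
  with B show "\<exists>y\<in>carrier SL2. y \<otimes>\<^bsub>SL2\<^esub> A = \<one>\<^bsub>SL2\<^esub>"
    by (auto simp: SL2_def)
qed (auto simp: SL2_def det_mul matrix_mul_assoc)

text \<open>Intended for finite groups \<open>G\<close>.\<close>

definition sylow_subgroups :: "nat \<Rightarrow> ('g, 'm) monoid_scheme \<Rightarrow> 'g set set" where
  "sylow_subgroups p G = {T. subgroup T G \<and> card T = p ^ multiplicity p (order G)}"

definition quotient_set :: "('g, 'm) monoid_scheme \<Rightarrow> 'g set \<Rightarrow> 'g set" where
  "quotient_set G D = {x \<otimes>\<^bsub>G\<^esub> inv\<^bsub>G\<^esub> y | x y. x \<in> D \<and> y \<in> D \<and> x \<noteq> y}"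

text \<open>
  The partition in the last two assumptions is one of an indexed family: distinct members of
  \<open>\<D>\<close> have disjoint quotient sets. As \<open>partition_on\<close> speaks about a set of sets, this needs
  the injectivity in addition. The remaining indices cannot clash, since the sets are nonempty
  and have different cardinalities for the three kinds of indices.
\<close>

locale affine_SL2_unital =
  fixes p :: nat and S :: "('a::{field,finite}^2^2) set" and \<D> :: "('a^2^2) set set"
  assumes S_subgroup: "subgroup S SL2"
    and card_S: "card S = CARD('a) + 1"
    and D_subset: "D \<in> \<D> \<Longrightarrow> D \<subseteq> carrier SL2"
    and one_in_D: "D \<in> \<D> \<Longrightarrow> \<one>\<^bsub>SL2\<^esub> \<in> D"
    and card_D: "D \<in> \<D> \<Longrightarrow> card D = CARD('a) + 1"
    and Q: "D \<in> \<D> \<Longrightarrow> card (quotient_set SL2 D) = CARD('a) * (CARD('a) + 1)"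
    and P_inj: "inj_on (quotient_set SL2) \<D>"
    and P: "partition_on (carrier SL2 - {\<one>\<^bsub>SL2\<^esub>})
              ({S - {\<one>\<^bsub>SL2\<^esub>}}
                \<union> {T - {\<one>\<^bsub>SL2\<^esub>} | T. T \<in> sylow_subgroups p SL2}
                \<union> {quotient_set SL2 D | D. D \<in> \<D>})"

text \<open>An incidence structure is a pair of a point set and a set of blocks, each block being
  the set of points on it.\<close>

type_synonym 'p incidence = "'p set \<times> 'p set set"

definition SL2_incidence ::
  "nat \<Rightarrow> ('a::{field,finite}^2^2) set \<Rightarrow> ('a^2^2) set set \<Rightarrow> ('a^2^2) incidence" where
  "SL2_incidence p S \<D> =
     (carrier SL2,
      {S #>\<^bsub>SL2\<^esub> g | g. g \<in> carrier SL2}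
      \<union> {T #>\<^bsub>SL2\<^esub> g | T g. T \<in> sylow_subgroups p SL2 \<and> g \<in> carrier SL2}
      \<union> {D #>\<^bsub>SL2\<^esub> g | D g. D \<in> \<D> \<and> g \<in> carrier SL2})"

definition short_blocks :: "nat \<Rightarrow> ('a::{field,finite}^2^2) incidence \<Rightarrow> ('a^2^2) set set" where
  "short_blocks p U =
     {B \<in> snd U. \<exists>T\<in>sylow_subgroups p SL2. \<exists>g\<in>carrier SL2. B = T #>\<^bsub>SL2\<^esub> g}"

definition parallelism ::
  "nat \<Rightarrow> ('a::{field,finite}^2^2) incidence \<Rightarrow> ('a^2^2) set set set \<Rightarrow> bool" where
  "parallelism p U \<pi> \<longleftrightarrow>
     partition_on (short_blocks p U) \<pi> \<and> card \<pi> = CARD('a) + 1 \<and>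
     (\<forall>C\<in>\<pi>. card C = CARD('a)\<^sup>2 - 1 \<and> disjoint C)"

definition flat_parallelism :: "nat \<Rightarrow> ('a::{field,finite}^2^2) set set set" where
  "flat_parallelism p =
     {{T #>\<^bsub>SL2\<^esub> g | g. g \<in> carrier SL2} | T. T \<in> sylow_subgroups p SL2}"

definition natural_parallelism :: "nat \<Rightarrow> ('a::{field,finite}^2^2) set set set" where
  "natural_parallelism p =
     {{g <#\<^bsub>SL2\<^esub> T | g. g \<in> carrier SL2} | T. T \<in> sylow_subgroups p SL2}"

end

theory Submission
  imports Defs "HOL-Algebra.Group_Action"
begin

text \<open>
  Counting points, every parallel class partitions the group, so it contains exactly one block
  through the identity, that is, exactly one Sylow subgroup \<open>T\<close>; right translation by elements
  of \<open>T\<close> fixes the block \<open>T\<close> and hence its class. As any two distinct Sylow subgroups generate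
  \<open>SL(2,q)\<close>, the stabilizer of a class is either the whole group or contains no Sylow subgroup
  other than \<open>T\<close>. If all stabilizers are the whole group, every class consists of the right
  cosets of its Sylow subgroup. If some stabilizer is proper, it normalizes \<open>T\<close>, so the orbit
  of the class is at least as large as the set of conjugates of \<open>T\<close>, which are all the Sylow
  subgroups; so the action on the classes is transitive, the class of \<open>T\<close> is translated by
  \<open>h\<close> to the class of the conjugate of \<open>T\<close> by \<open>h\<close>, and the classes consist of left cosets.
\<close>

section \<open>Translation-invariant partitions of cosets\<close>

text \<open>\<open>P\<close> stands for the set of Sylow subgroups and \<open>\<pi>\<close> for the
  parallelism. What matters about \<open>P\<close> is closure under conjugation, conjugacy of its
  members, and that any two distinct members generate the group.\<close>

locale invariant_coset_partition = group G for G (structure) +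
  fixes P :: "'a set set" and \<pi> :: "'a set set set"
  assumes finite_carrier: "finite (carrier G)"
    and subgroups: "T \<in> P \<Longrightarrow> subgroup T G"
    and conjugate_closed: "\<lbrakk>T \<in> P; h \<in> carrier G\<rbrakk> \<Longrightarrow> inv h <#\<^bsub>G\<^esub> T #> h \<in> P"
    and conjugate: "\<lbrakk>T \<in> P; T' \<in> P\<rbrakk> \<Longrightarrow> \<exists>h\<in>carrier G. T' = inv h <#\<^bsub>G\<^esub> T #> h"
    and generate_carrier:
      "\<lbrakk>subgroup H G; T \<in> P; T' \<in> P; T \<noteq> T'; T \<subseteq> H; T' \<subseteq> H\<rbrakk> \<Longrightarrow> H = carrier G"
    and partition: "partition_on {T #> g | T g. T \<in> P \<and> g \<in> carrier G} \<pi>"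
    and disjoint_class: "C \<in> \<pi> \<Longrightarrow> disjoint C"
    and Union_class: "C \<in> \<pi> \<Longrightarrow> \<Union> C = carrier G"
    and translate_class: "\<lbrakk>C \<in> \<pi>; h \<in> carrier G\<rbrakk> \<Longrightarrow> (\<lambda>B. B #> h) ` C \<in> \<pi>"
begin

abbreviation translate :: "'a set set \<Rightarrow> 'a \<Rightarrow> 'a set set" where
  "translate C h \<equiv> (\<lambda>B. B #> h) ` C"

definition class_stabilizer :: "'a set set \<Rightarrow> 'a set" where
  "class_stabilizer C = {h \<in> carrier G. translate C h = C}"

section \<open>Blocks and parallel classes\<close>

lemma member_subset: "T \<in> P \<Longrightarrow> T \<subseteq> carrier G"
  by (simp add: subgroup.subset subgroups)

lemma block_cases:
  assumes "C \<in> \<pi>" "B \<in> C"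
  obtains T g where "T \<in> P" "g \<in> carrier G" "B = T #> g"
  using partition_onD1[OF partition] assms by blast

lemma block_subset: "\<lbrakk>C \<in> \<pi>; B \<in> C\<rbrakk> \<Longrightarrow> B \<subseteq> carrier G"
  using Union_class by blast

lemma block_nonempty:
  assumes "C \<in> \<pi>" "B \<in> C"
  shows "B \<noteq> {}"
  using assms by (metis block_cases empty_iff rcos_self subgroups)

lemma class_unique: "\<lbrakk>C \<in> \<pi>; C' \<in> \<pi>; B \<in> C; B \<in> C'\<rbrakk> \<Longrightarrow> C = C'"
  using partition_onD2[OF partition] by (auto simp: disjoint_def)

lemma ex_class:
  assumes "T \<in> P" "g \<in> carrier G"
  obtains C where "C \<in> \<pi>" "T #> g \<in> C"
proof -
  have "T #> g \<in> \<Union> \<pi>"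
    using partition_onD1[OF partition] assms by blast
  then show ?thesis
    using that by blast
qed

lemma ex_class_of_member:
  assumes "T \<in> P"
  obtains C where "C \<in> \<pi>" "T \<in> C"
  using ex_class[OF assms one_closed] member_subset[OF assms] by (metis coset_mult_one)

text \<open>The class covers the identity, and a coset \<open>T #> g\<close> that contains the
  identity is \<open>T\<close> itself.\<close>

lemma ex_member_of_class:
  assumes "C \<in> \<pi>"
  obtains T where "T \<in> P" "T \<in> C"
proof -
  obtain B where B: "B \<in> C" "\<one> \<in> B"
    using Union_class[OF assms] one_closed by blast
  then obtain T g where T: "T \<in> P" "g \<in> carrier G" "B = T #> g"
    using block_cases assms by metis
  then have "T #> g = T #> \<one>"
    using B repr_independence[of \<one> T g] subgroups by auto
  then have "B = T"
    using T member_subset by auto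
  with B T show ?thesis
    by (intro that[of T]) simp_all
qed

text \<open>Two subgroups share the identity, whereas distinct blocks of a class are
  disjoint.\<close>

lemma member_unique:
  assumes "C \<in> \<pi>" "T \<in> P" "T' \<in> P" "T \<in> C" "T' \<in> C"
  shows "T = T'"
proof -
  have "\<one> \<in> T \<inter> T'"
    using assms subgroups subgroup.one_closed by blast
  then show ?thesis
    using disjointD[OF disjoint_class[OF assms(1)]] assms by blast
qed

section \<open>Translates of classes and their stabilizers\<close>

lemma translate_translate:
  assumes "C \<in> \<pi>" "g \<in> carrier G" "h \<in> carrier G"
  shows "translate (translate C g) h = translate C (g \<otimes> h)"
  using assms block_subset coset_mult_assoc by (auto simp: image_image intro!: image_cong)

lemma translate_one:
  assumes "C \<in> \<pi>"
  shows "translate C \<one> = C"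
proof -
  have "translate C \<one> = id ` C"
    using assms block_subset by (intro image_cong) auto
  then show ?thesis by simp
qed

lemma translate_inv_eq:
  assumes "C \<in> \<pi>" "h \<in> carrier G" "translate C h = C'"
  shows "translate C' (inv h) = C"
  using translate_translate[OF assms(1,2), of "inv h"] assms by (simp add: translate_one)

lemma subgroup_class_stabilizer:
  assumes "C \<in> \<pi>"
  shows "subgroup (class_stabilizer C) G"
proof (rule subgroupI)
  show "class_stabilizer C \<subseteq> carrier G" by (auto simp: class_stabilizer_def)
  have "\<one> \<in> class_stabilizer C"
    using assms translate_one by (simp add: class_stabilizer_def)
  then show "class_stabilizer C \<noteq> {}" by blast
next
  fix a assume "a \<in> class_stabilizer C"
  then show "inv a \<in> class_stabilizer C"
    using assms translate_inv_eq by (simp add: class_stabilizer_def)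
next
  fix a b assume "a \<in> class_stabilizer C" "b \<in> class_stabilizer C"
  then show "a \<otimes> b \<in> class_stabilizer C"
    using assms translate_translate[of C a b] by (simp add: class_stabilizer_def)
qed

lemma member_subset_class_stabilizer:
  assumes "C \<in> \<pi>" "T \<in> P" "T \<in> C"
  shows "T \<subseteq> class_stabilizer C"
proof
  fix t assume t: "t \<in> T"
  then have tG: "t \<in> carrier G"
    using assms member_subset by blast
  have "T #> t = T"
    using t tG assms subgroups coset_join2 by blast
  then have "T \<in> translate C t"
    using assms by (metis imageI)
  \<comment> \<open>\<open>T\<close> is a block of \<open>C\<close> and of its translate, and a
    block lies in only one class.\<close>
  then have "translate C t = C"
    using class_unique translate_class assms tG by blast
  then show "t \<in> class_stabilizer C"
    using tG by (simp add: class_stabilizer_def)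
qed

text \<open>The stabilizer of a translate is the conjugate of the stabilizer, and \<open>T\<close>
  lies in the stabilizer of \<open>C\<close>.\<close>

lemma conjugate_subset_class_stabilizer:
  assumes "C \<in> \<pi>" "T \<in> P" "T \<in> C" "h \<in> carrier G"
  shows "inv h <#\<^bsub>G\<^esub> T #> h \<subseteq> class_stabilizer (translate C h)"
proof
  fix x assume "x \<in> inv h <#\<^bsub>G\<^esub> T #> h"
  then obtain t where t: "t \<in> T" "x = inv h \<otimes> t \<otimes> h"
    by (auto simp: l_coset_def r_coset_def)
  then have tG: "t \<in> carrier G" and "translate C t = C"
    using subsetD[OF member_subset_class_stabilizer[OF assms(1-3)] t(1)]
    by (simp_all add: class_stabilizer_def)
  \<comment> \<open>Hence \<open>x\<close> moves \<open>translate C h\<close> to the translate of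
    \<open>C\<close> by \<open>t \<otimes> h\<close>, which is \<open>translate C h\<close> again
    because \<open>t\<close> stabilizes \<open>C\<close>.\<close>
  moreover have "h \<otimes> x = t \<otimes> h"
    using t tG assms by (simp add: inv_solve_left' m_assoc[symmetric])
  moreover have "x \<in> carrier G"
    using t tG assms by simp
  ultimately show "x \<in> class_stabilizer (translate C h)"
    using translate_translate[of C t h] translate_translate[of C h x] assms
    by (simp add: class_stabilizer_def)
qed

text \<open>Every block of \<open>C\<close> is nonempty, so it meets some block of \<open>X\<close>
  and by disjointness equals it. Thus a class is known once enough of its blocks are found to cover
  the group.\<close>

lemma subset_class_eq:
  assumes "C \<in> \<pi>" "X \<subseteq> C" "carrier G \<subseteq> \<Union> X"
  shows "C = X"
proof -
  have "B \<in> X" if B: "B \<in> C" for B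
  proof -
    obtain x where "x \<in> B" "x \<in> carrier G"
      using block_nonempty[OF assms(1) B] block_subset[OF assms(1) B] by blast
    then obtain B' where "B' \<in> X" "x \<in> B'"
      using assms by blast
    then show ?thesis
      using B assms \<open>x \<in> B\<close> disjointD[OF disjoint_class[OF assms(1)], of B B'] by blast
  qed
  with assms show ?thesis by blast
qed

text \<open>Every class contains a member of \<open>P\<close> and every member lies in a class, so
  it suffices to determine each class from the member in it.\<close>

lemma partition_eq_image:
  assumes "\<And>C T. \<lbrakk>C \<in> \<pi>; T \<in> P; T \<in> C\<rbrakk> \<Longrightarrow> C = F T"
  shows "\<pi> = F ` P"
proof
  show "\<pi> \<subseteq> F ` P"
    using assms by (metis ex_member_of_class image_eqI subsetI)
  show "F ` P \<subseteq> \<pi>"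
    using assms by (metis ex_class_of_member image_subsetI)
qed

section \<open>Right cosets or left cosets\<close>

lemma all_stable_imp_right_cosets:
  assumes "\<And>C. C \<in> \<pi> \<Longrightarrow> class_stabilizer C = carrier G"
  shows "\<pi> = (\<lambda>T. {T #> g | g. g \<in> carrier G}) ` P"
proof (rule partition_eq_image)
  fix C T assume C: "C \<in> \<pi>" "T \<in> P" "T \<in> C"
  show "C = {T #> g | g. g \<in> carrier G}"
  proof (rule subset_class_eq[OF C(1)])
    show "{T #> g | g. g \<in> carrier G} \<subseteq> C"
      using assms[OF C(1)] C(3) by (auto simp: class_stabilizer_def)
    show "carrier G \<subseteq> \<Union> {T #> g | g. g \<in> carrier G}"
      using rcos_self subgroups[OF C(2)] by blast
  qed
qed

text \<open>Sending a subgroup to the class that contains it reaches every class. The bound is one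
  half of the count that later proves transitivity on the classes.\<close>

lemma card_classes_le: "card \<pi> \<le> card P"
proof -
  have "P \<subseteq> Pow (carrier G)"
    using member_subset by blast
  then have fin: "finite P"
    using finite_carrier finite_subset by blast
  define f where "f T = (SOME C. C \<in> \<pi> \<and> T \<in> C)" for T
  have "\<pi> \<subseteq> f ` P"
  proof
    fix C assume C: "C \<in> \<pi>"
    then obtain T where T: "T \<in> P" "T \<in> C"
      by (rule ex_member_of_class)
    then have "f T \<in> \<pi> \<and> T \<in> f T"
      unfolding f_def using C by (intro someI[where P = "\<lambda>C. C \<in> \<pi> \<and> T \<in> C"] conjI)
    then show "C \<in> f ` P"
      using class_unique[OF _ C] T by blast
  qed
  then show ?thesis
    using fin surj_card_le by blast
qed

text \<open>Translates of \<open>C\<close> have conjugate stabilizers, which are therefore proper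
  too. So the conjugate of \<open>T\<close> and the member of \<open>P\<close> in
  \<open>translate C h\<close>, both inside that proper stabilizer, must coincide. Thus the
  translates of \<open>C\<close> contain all members of \<open>P\<close>, one in each, and number at
  least \<open>card P\<close>, which is at least \<open>card \<pi>\<close>.\<close>

lemma
  assumes C: "C \<in> \<pi>" and T: "T \<in> P" "T \<in> C" and proper: "class_stabilizer C \<noteq> carrier G"
  shows conjugate_mem_translate:
      "h \<in> carrier G \<Longrightarrow> inv h <#\<^bsub>G\<^esub> T #> h \<in> translate C h"
    and translates_eq: "\<pi> = translate C ` carrier G"
proof -
  have proper_translate: "class_stabilizer (translate C h) \<noteq> carrier G"
    if h: "h \<in> carrier G" for h
  proof
    assume eq: "class_stabilizer (translate C h) = carrier G"
    have "x \<in> class_stabilizer C" if x: "x \<in> carrier G" for x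
    proof -
      \<comment> \<open>Translating by \<open>h\<close> and then by this conjugate of
        \<open>x\<close> is translating by \<open>x \<otimes> h\<close>; cancelling \<open>h\<close>
        shows that \<open>x\<close> stabilizes \<open>C\<close>.\<close>
      have "inv h \<otimes> x \<otimes> h \<in> class_stabilizer (translate C h)"
        using eq h x by simp
      then have "translate C (h \<otimes> (inv h \<otimes> x \<otimes> h)) = translate C h"
        using C h x by (simp add: class_stabilizer_def translate_translate)
      moreover have "h \<otimes> (inv h \<otimes> x \<otimes> h) = x \<otimes> h"
        using h x by (simp add: m_assoc[symmetric])
      ultimately have "translate (translate C x) h = translate C h"
        using C h x by (simp add: translate_translate)
      then have "translate C x = translate (translate C h) (inv h)"
        using translate_inv_eq[of "translate C x" h] C h x translate_class by simp
      also have "\<dots> = C"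
        using C h translate_inv_eq by blast
      finally show ?thesis
        using x by (simp add: class_stabilizer_def)
    qed
    then show False
      using proper by (auto simp: class_stabilizer_def)
  qed
  show mem: "inv h <#\<^bsub>G\<^esub> T #> h \<in> translate C h" if h: "h \<in> carrier G" for h
  proof -
    have Ch: "translate C h \<in> \<pi>"
      using C h translate_class by blast
    then obtain T' where T': "T' \<in> P" "T' \<in> translate C h"
      by (rule ex_member_of_class)
    have "inv h <#\<^bsub>G\<^esub> T #> h = T'"
    proof (rule ccontr)
      assume "inv h <#\<^bsub>G\<^esub> T #> h \<noteq> T'"
      then have "class_stabilizer (translate C h) = carrier G"
        using generate_carrier[OF subgroup_class_stabilizer[OF Ch] conjugate_closed[OF T(1) h] T'(1)]
          conjugate_subset_class_stabilizer[OF C T h]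
          member_subset_class_stabilizer[OF Ch T'] by blast
      then show False
        using proper_translate[OF h] by contradiction
    qed
    then show ?thesis using T' by simp
  qed
  \<comment> \<open>A class has only one member of \<open>P\<close>, so the choice is forced there
    and \<open>f\<close> maps the translates of \<open>C\<close> onto \<open>P\<close>.\<close>
  define f where "f C' = (SOME T'. T' \<in> P \<and> T' \<in> C')" for C'
  have fin: "finite (translate C ` carrier G)"
    using finite_carrier by blast
  have "P \<subseteq> f ` translate C ` carrier G"
  proof
    fix T' assume T': "T' \<in> P"
    then obtain h where h: "h \<in> carrier G" "T' = inv h <#\<^bsub>G\<^esub> T #> h"
      using conjugate[OF T(1)] by blast
    then have "T' \<in> translate C h"
      using mem by blast
    moreover from this have "f (translate C h) \<in> P \<and> f (translate C h) \<in> translate C h"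
      unfolding f_def using T' by (intro someI[where P = "\<lambda>T. T \<in> P \<and> T \<in> translate C h"] conjI)
    ultimately have "f (translate C h) = T'"
      using member_unique[OF translate_class[OF C h(1)]] T' by blast
    then show "T' \<in> f ` translate C ` carrier G"
      using h by blast
  qed
  then have "card P \<le> card (translate C ` carrier G)"
    using fin surj_card_le by blast
  moreover have sub: "translate C ` carrier G \<subseteq> \<pi>"
    using C translate_class by blast
  moreover have "finite \<pi>"
  proof -
    have "\<pi> \<subseteq> Pow (Pow (carrier G))"
      using block_subset by (meson PowI subsetI)
    then show ?thesis
      using finite_carrier by (meson finite_Pow_iff finite_subset)
  qed
  ultimately show "\<pi> = translate C ` carrier G"
    using card_classes_le by (metis card_seteq le_trans)
qed

lemma unstable_imp_left_cosets:
  assumes C0: "C0 \<in> \<pi>" and "class_stabilizer C0 \<noteq> carrier G"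
  shows "\<pi> = (\<lambda>T. {g <#\<^bsub>G\<^esub> T | g. g \<in> carrier G}) ` P"
proof (rule partition_eq_image)
  obtain T0 where T0: "T0 \<in> P" "T0 \<in> C0"
    using ex_member_of_class[OF C0] by blast
  note T0G = member_subset[OF T0(1)]
  note mem = conjugate_mem_translate[OF C0 T0 assms(2)]
  fix C T assume C: "C \<in> \<pi>" "T \<in> P" "T \<in> C"
  then obtain h where h: "h \<in> carrier G" "C = translate C0 h"
    using translates_eq[OF C0 T0 assms(2)] by blast
  then have T: "T = inv h <#\<^bsub>G\<^esub> T0 #> h"
    using member_unique[OF C(1,2) conjugate_closed[OF T0(1)]] C(3) mem by blast
  show "C = {g <#\<^bsub>G\<^esub> T | g. g \<in> carrier G}"
  proof (rule subset_class_eq[OF C(1)])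
    have "g <#\<^bsub>G\<^esub> T \<in> C" if g: "g \<in> carrier G" for g
    proof -
      \<comment> \<open>With this \<open>?k\<close>, the coset \<open>g <# T\<close> is the
        conjugate of \<open>T0\<close> by \<open>?k\<close> followed by right translation by
        \<open>g\<close>. That conjugate lies in \<open>translate C0 ?k\<close>, which
        \<open>g\<close> moves to \<open>C\<close> because
        \<open>?k \<otimes> g = h\<close>.\<close>
      let ?k = "h \<otimes> inv g"
      have k: "?k \<in> carrier G" "inv ?k = g \<otimes> inv h" "?k \<otimes> g = h"
        using g h by (simp_all add: inv_mult_group m_assoc)
      have "inv ?k <#\<^bsub>G\<^esub> T0 #> ?k #> g \<in> translate (translate C0 ?k) g"
        using mem[OF k(1)] by blast
      also have "translate (translate C0 ?k) g = C"
        using translate_translate[OF C0 k(1) g] k h by simp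
      also have "inv ?k <#\<^bsub>G\<^esub> T0 #> ?k #> g = inv ?k <#\<^bsub>G\<^esub> T0 #> h"
        using k(1,3) g T0G by (simp add: coset_mult_assoc l_coset_subset_G)
      also have "\<dots> = g <#\<^bsub>G\<^esub> (inv h <#\<^bsub>G\<^esub> T0) #> h"
        using g h T0G by (simp add: lcos_m_assoc k(2))
      also have "\<dots> = g <#\<^bsub>G\<^esub> T"
        unfolding T using g h T0G by (simp add: coset_assoc l_coset_subset_G)
      finally show ?thesis .
    qed
    then show "{g <#\<^bsub>G\<^esub> T | g. g \<in> carrier G} \<subseteq> C" by blast
    have "g \<in> g <#\<^bsub>G\<^esub> T" if "g \<in> carrier G" for g
      using that subgroup.one_closed[OF subgroups[OF C(2)]] by (force simp: l_coset_def)
    then show "carrier G \<subseteq> \<Union> {g <#\<^bsub>G\<^esub> T | g. g \<in> carrier G}" by blast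
  qed
qed

theorem right_or_left_cosets:
  "\<pi> = (\<lambda>T. {T #> g | g. g \<in> carrier G}) ` P \<or> \<pi> = (\<lambda>T. {g <#\<^bsub>G\<^esub> T | g. g \<in> carrier G}) ` P"
  using all_stable_imp_right_cosets unstable_imp_left_cosets by blast

end

section \<open>Sylow subgroups of SL(2,q)\<close>

text \<open>Orbit sizes divide a power of \<open>p\<close>; since \<open>p\<close> does not divide
  their sum, some orbit is a single point. This will give a subgroup of order q a nonzero fixed
  vector.\<close>

lemma (in group_action) p_group_fixed_point:
  assumes "prime p" "order G = p ^ n" "finite E" "\<not> p dvd card E"
  shows "\<exists>x\<in>E. \<forall>g\<in>carrier G. \<phi> g x = x"
proof -
  have "(\<Sum>orb\<in>orbits G E \<phi>. card orb) = card E"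
    using disjoint_sum[OF assms(3), of "\<lambda>_. 1::nat"] by simp
  then obtain orb where orb: "orb \<in> orbits G E \<phi>" "\<not> p dvd card orb"
    using assms(4) by (metis dvd_sum)
  then obtain x where x: "x \<in> E" "orb = orbit G \<phi> x"
    by (auto simp: orbits_def)
  have "card orb dvd p ^ n"
    using orbit_stabilizer_theorem[OF x(1)] assms(2) x(2) by (metis dvd_triv_left)
  then obtain k where "card orb = p ^ k"
    using divides_primepow_nat[OF assms(1)] by blast
  then have "card orb = 1"
    using orb(2) by (cases k) auto
  then obtain y where "orb = {y}"
    by (auto simp: card_1_singleton_iff)
  then have "\<phi> g x = x" if "g \<in> carrier G" for g
    using that orbit_refl[OF x(1)] x(2) by (auto simp: orbit_def)
  with x(1) show ?thesis by blast
qed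

section \<open>Matrices of determinant 1 and nonzero vectors\<close>

interpretation SL2: group "SL2 :: ('a::{field,finite}^2^2) monoid"
  by (rule group_SL2)

lemma SL2_simps [simp]:
  "A \<in> carrier SL2 \<longleftrightarrow> det A = 1" "A \<otimes>\<^bsub>SL2\<^esub> B = A ** B" "\<one>\<^bsub>SL2\<^esub> = mat 1"
  by (auto simp: SL2_def)

lemma SL2_inv:
  assumes "det A = 1"
  shows "det (inv\<^bsub>SL2\<^esub> A) = 1" "A ** inv\<^bsub>SL2\<^esub> A = mat 1" "inv\<^bsub>SL2\<^esub> A ** A = mat 1"
  using SL2.inv_closed[of A] SL2.r_inv[of A] SL2.l_inv[of A] assms by simp_all

lemma SL2_inv_vector:
  assumes "det A = 1"
  shows "A *v (inv\<^bsub>SL2\<^esub> A *v v) = v" "inv\<^bsub>SL2\<^esub> A *v (A *v v) = v"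
  using SL2_inv[OF assms] by (simp_all add: matrix_vector_mul_assoc)

definition mat22 :: "'a \<Rightarrow> 'a \<Rightarrow> 'a \<Rightarrow> 'a \<Rightarrow> 'a::field^2^2" where
  "mat22 a b c d = vector [vector [a, b], vector [c, d]]"

lemma mat22_nth [simp]:
  "mat22 a b c d $ 1 $ 1 = a" "mat22 a b c d $ 1 $ 2 = b"
  "mat22 a b c d $ 2 $ 1 = c" "mat22 a b c d $ 2 $ 2 = d"
  by (simp_all add: mat22_def)

lemma matrix22_eq_iff:
  "(A :: 'a^2^2) = B \<longleftrightarrow>
    A $ 1 $ 1 = B $ 1 $ 1 \<and> A $ 1 $ 2 = B $ 1 $ 2 \<and> A $ 2 $ 1 = B $ 2 $ 1 \<and> A $ 2 $ 2 = B $ 2 $ 2"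
  by (auto simp: vec_eq_iff forall_2)

lemma matrix22_mult_nth: "((A :: 'a::field^2^2) ** B) $ i $ j = A $ i $ 1 * B $ 1 $ j + A $ i $ 2 * B $ 2 $ j"
  by (simp add: matrix_matrix_mult_def sum_2)

lemma matrix22_vector_nth: "((A :: 'a::field^2^2) *v x) $ i = A $ i $ 1 * x $ 1 + A $ i $ 2 * x $ 2"
  by (simp add: matrix_vector_mult_def sum_2)

lemma vec2_eq_iff: "(x :: 'a^2) = y \<longleftrightarrow> x $ 1 = y $ 1 \<and> x $ 2 = y $ 2"
  by (auto simp: vec_eq_iff forall_2)

lemma vec2_nonzero_iff: "(x :: 'a::field^2) \<noteq> 0 \<longleftrightarrow> x $ 1 \<noteq> 0 \<or> x $ 2 \<noteq> 0"
  by (simp add: vec2_eq_iff)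

lemma SL2_vector_eq_0_iff:
  assumes "det A = 1"
  shows "A *v (v :: 'a::{field,finite}^2) = 0 \<longleftrightarrow> v = 0"
  using SL2_inv_vector(2)[OF assms, of v] by auto

text \<open>\<open>A *v axis 1 1\<close> is the first column of \<open>A\<close>, so it is enough to
  complete \<open>v\<close> by a second column to determinant 1; the choice depends on which
  coordinate of \<open>v\<close> can be inverted.\<close>

lemma SL2_ex_first_column:
  assumes "(v :: 'a::{field,finite}^2) \<noteq> 0"
  obtains A where "det A = 1" "A *v axis 1 1 = v"
proof (cases "v $ 1 = 0")
  case True
  with assms show ?thesis
    by (intro that[of "mat22 0 (- 1 / v $ 2) (v $ 2) 0"])
       (simp_all add: det_2 vec2_nonzero_iff vec2_eq_iff matrix22_vector_nth axis_def)
next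
  case False
  then show ?thesis
    by (intro that[of "mat22 (v $ 1) 0 (v $ 2) (1 / v $ 1)"])
       (simp_all add: det_2 vec2_eq_iff matrix22_vector_nth axis_def)
qed

lemma SL2_transitive:
  assumes "(v :: 'a::{field,finite}^2) \<noteq> 0" "w \<noteq> 0"
  obtains A where "det A = 1" "A *v v = w"
proof -
  obtain B where B: "det B = 1" "B *v axis 1 1 = v"
    using SL2_ex_first_column[OF assms(1)] .
  obtain C where C: "det C = 1" "C *v axis 1 1 = w"
    using SL2_ex_first_column[OF assms(2)] .
  show ?thesis
  proof (rule that)
    show "det (C ** inv\<^bsub>SL2\<^esub> B) = 1"
      using B C SL2_inv by (simp add: det_mul)
    show "(C ** inv\<^bsub>SL2\<^esub> B) *v v = w"
      using B C SL2_inv_vector(2)[OF B(1), of "axis 1 1"]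
      by (simp add: matrix_vector_mul_assoc[symmetric])
  qed
qed

section \<open>Vector stabilizers, later identified with the Sylow subgroups\<close>

definition fixer :: "'a::{field,finite}^2 \<Rightarrow> ('a^2^2) set" where
  "fixer v = {A. det A = 1 \<and> A *v v = v}"

lemma subgroup_fixer: "subgroup (fixer v) SL2"
proof (rule SL2.subgroupI)
  have "mat 1 \<in> fixer v" by (simp add: fixer_def)
  then show "fixer v \<noteq> {}" by blast
  show "inv\<^bsub>SL2\<^esub> A \<in> fixer v" if "A \<in> fixer v" for A
    using that SL2_inv SL2_inv_vector(2)[of A v] by (auto simp: fixer_def)
qed (auto simp: fixer_def det_mul matrix_vector_mul_assoc[symmetric])

text \<open>This provides closure under conjugation and, together with
  \<open>SL2_transitive\<close>, conjugacy of the stabilizers of nonzero vectors.\<close>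

lemma conjugate_fixer:
  assumes "det h = 1"
  shows "inv\<^bsub>SL2\<^esub> h <#\<^bsub>SL2\<^esub> fixer v #>\<^bsub>SL2\<^esub> h = fixer (inv\<^bsub>SL2\<^esub> h *v v)"
proof -
  note h = SL2_inv[OF assms] SL2_inv_vector[OF assms]
  have "\<exists>A\<in>fixer v. B = inv\<^bsub>SL2\<^esub> h ** A ** h" if "B \<in> fixer (inv\<^bsub>SL2\<^esub> h *v v)" for B
  proof
    show "h ** B ** inv\<^bsub>SL2\<^esub> h \<in> fixer v"
      using that h assms by (simp add: fixer_def det_mul matrix_vector_mul_assoc[symmetric])
    have "inv\<^bsub>SL2\<^esub> h ** (h ** B ** inv\<^bsub>SL2\<^esub> h) ** h = (inv\<^bsub>SL2\<^esub> h ** h) ** B ** (inv\<^bsub>SL2\<^esub> h ** h)"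
      by (simp add: matrix_mul_assoc)
    then show "B = inv\<^bsub>SL2\<^esub> h ** (h ** B ** inv\<^bsub>SL2\<^esub> h) ** h"
      using h by simp
  qed
  moreover have "inv\<^bsub>SL2\<^esub> h ** A ** h \<in> fixer (inv\<^bsub>SL2\<^esub> h *v v)" if "A \<in> fixer v" for A
    using that h assms by (simp add: fixer_def det_mul matrix_vector_mul_assoc[symmetric])
  ultimately show ?thesis
    by (force simp: l_coset_def r_coset_def)
qed

text \<open>The matrix of the map taking \<open>x\<close> to
  \<open>x + (t * (v$1 * x$2 - v$2 * x$1)) *s v\<close>.\<close>

definition transvection :: "'a::field^2 \<Rightarrow> 'a \<Rightarrow> 'a^2^2" where
  "transvection v t =
    mat22 (1 - t * v $ 1 * v $ 2) (t * (v $ 1)\<^sup>2) (- t * (v $ 2)\<^sup>2) (1 + t * v $ 1 * v $ 2)"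

text \<open>Parametrizing the stabilizer by field elements is what yields its order in
  \<open>card_fixer\<close>.\<close>

lemma fixer_eq_range_transvection:
  assumes "v \<noteq> 0"
  shows "fixer v = range (transvection v)"
proof
  show "range (transvection v) \<subseteq> fixer v"
    by (auto simp: fixer_def transvection_def det_2 vec2_eq_iff matrix22_vector_nth power2_eq_square
        algebra_simps)
  show "fixer v \<subseteq> range (transvection v)"
  proof
    fix A assume "A \<in> fixer v"
    then have det: "A$1$1 * A$2$2 - A$1$2 * A$2$1 = 1"
      and r1: "A$1$1 * v$1 + A$1$2 * v$2 = v$1" and r2: "A$2$1 * v$1 + A$2$2 * v$2 = v$2"
      by (auto simp: fixer_def det_2 vec2_eq_iff matrix22_vector_nth)
    \<comment> \<open>\<open>i1\<close> and \<open>i2\<close> say that the inverse of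
      \<open>A\<close>, its adjugate, fixes \<open>v\<close> as well.\<close>
    have i1: "A$2$2 * v$1 - A$1$2 * v$2 = v$1"
      using det r1 r2 by algebra
    have i2: "A$1$1 * v$2 - A$2$1 * v$1 = v$2"
      using det r1 r2 by algebra
    show "A \<in> range (transvection v)"
    proof (cases "v $ 1 = 0")
      case True
      then have v: "v $ 2 \<noteq> 0"
        using assms by (simp add: vec2_nonzero_iff)
      \<comment> \<open>As \<open>v $ 1 = 0\<close>, the parameter has to be read off from the lower
        left entry \<open>- t * (v $ 2)\<^sup>2\<close>; in the other case the upper right entry
        gives it.\<close>
      have "A = transvection v (- A$2$1 / (v$2)\<^sup>2)"
        using True v r1 r2 i1 i2 by (simp add: matrix22_eq_iff transvection_def)
      then show ?thesis by blast
    next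
      case False
      have "A$1$1 = 1 - A$1$2 * v$2 / v$1" "A$2$2 = 1 + A$1$2 * v$2 / v$1"
        using False r1 i1 by (simp_all add: field_simps)
      moreover have "A$2$1 * (v$1)\<^sup>2 = - A$1$2 * (v$2)\<^sup>2"
      proof -
        have "A$2$1 * (v$1)\<^sup>2 = v$1 * (A$1$1 * v$2 - v$2)"
          using i2 by (simp add: power2_eq_square algebra_simps)
        also have "\<dots> = v$2 * (A$1$1 * v$1 - v$1)"
          by (simp add: algebra_simps)
        also have "A$1$1 * v$1 - v$1 = - A$1$2 * v$2"
          using r1 by (simp add: algebra_simps)
        finally show ?thesis
          by (simp add: power2_eq_square mult_ac)
      qed
      then have "A$2$1 = - A$1$2 * (v$2)\<^sup>2 / (v$1)\<^sup>2"
        using False by (metis nonzero_eq_divide_eq power_not_zero)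
      ultimately have "A = transvection v (A$1$2 / (v$1)\<^sup>2)"
        using False by (simp add: matrix22_eq_iff transvection_def power2_eq_square)
      then show ?thesis by blast
    qed
  qed
qed

lemma card_fixer:
  assumes "(v :: 'a::{field,finite}^2) \<noteq> 0"
  shows "card (fixer v) = CARD('a)"
proof -
  have "inj (transvection v)"
    using assms by (auto simp: inj_def transvection_def matrix22_eq_iff vec2_nonzero_iff)
  then show ?thesis
    using assms by (simp add: fixer_eq_range_transvection card_image)
qed

section \<open>Order and Sylow subgroups\<close>

abbreviation SL2_act :: "'a::{field,finite}^2^2 \<Rightarrow> 'a^2 \<Rightarrow> 'a^2" where
  "SL2_act A \<equiv> restrict ((*v) A) (- {0})"

text \<open>Members of \<open>Bij\<close> are extensional, so each map is restricted and takes the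
  value \<open>undefined\<close> at 0.\<close>

lemma SL2_action: "group_action SL2 (- {0}) (SL2_act :: 'a::{field,finite}^2^2 \<Rightarrow> _)"
proof -
  have bij: "SL2_act A \<in> Bij (- {0})" if "det A = 1" for A :: "'a^2^2"
  proof -
    have "bij_betw (SL2_act A) (- {0}) (- {0})"
      using that SL2_inv[OF that] SL2_inv_vector[OF that]
      by (intro bij_betwI[where g = "(*v) (inv\<^bsub>SL2\<^esub> A)"]) (auto simp: SL2_vector_eq_0_iff)
    then show ?thesis
      by (simp add: Bij_def)
  qed
  have "SL2_act (A ** B) = compose (- {0}) (SL2_act A) (SL2_act B)" if "det B = 1" for A B :: "'a^2^2"
    using that by (auto simp: compose_def fun_eq_iff SL2_vector_eq_0_iff matrix_vector_mul_assoc)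
  with bij have "SL2_act \<in> hom SL2 (BijGroup (- {0} :: ('a^2) set))"
    by (auto simp: hom_def BijGroup_def)
  then show ?thesis
    by (simp add: group_action_def group_hom_def group_hom_axioms_def group_SL2 group_BijGroup)
qed

lemma card_nonzero_vectors: "card (- {0 :: 'a::{field,finite}^2}) = CARD('a)\<^sup>2 - 1"
  by (simp add: card_Diff_singleton Compl_eq_Diff_UNIV)

text \<open>Orbit-stabilizer for the first unit vector, whose orbit consists of all nonzero
  vectors.\<close>

lemma order_SL2: "order (SL2 :: ('a::{field,finite}^2^2) monoid) = (CARD('a)\<^sup>2 - 1) * CARD('a)"
proof -
  let ?e = "axis 1 1 :: 'a^2"
  have e: "?e \<noteq> 0" by simp
  have "orbit SL2 SL2_act ?e = - {0}"
    using e by (auto simp: orbit_def SL2_vector_eq_0_iff) (metis SL2_ex_first_column)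
  moreover have "stabilizer SL2 SL2_act ?e = fixer ?e"
    using e by (auto simp: stabilizer_def fixer_def)
  ultimately show ?thesis
    using group_action.orbit_stabilizer_theorem[OF SL2_action, of ?e] e
    by (simp add: card_fixer card_nonzero_vectors)
qed

text \<open>As \<open>p\<close> does not divide \<open>q^2 - 1\<close>, the Sylow subgroups have
  order q. Such a subgroup, acting on the \<open>q^2 - 1\<close> nonzero vectors, fixes one of them
  and so lies in its stabilizer, which has the same order.\<close>

lemma sylow_subgroups_SL2:
  assumes p: "prime p" and q: "CARD('a::{field,finite}) = p ^ e"
  shows "sylow_subgroups p SL2 = fixer ` (- {0 :: 'a^2})"
proof -
  \<comment> \<open>This excludes \<open>e = 0\<close>.\<close>
  have "CARD('a) > 1"
    using card_mono[of UNIV "{0, 1 :: 'a}"] by simp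
  then have "p dvd CARD('a)"
    using q by (cases e) auto
  then have ndvd: "\<not> p dvd CARD('a)\<^sup>2 - 1"
  proof -
    have "p dvd CARD('a)\<^sup>2"
      using \<open>p dvd CARD('a)\<close> by (simp add: power2_eq_square)
    moreover have "CARD('a)\<^sup>2 - (CARD('a)\<^sup>2 - 1) = 1"
      using \<open>CARD('a) > 1\<close> by (simp add: Suc_leI)
    ultimately show ?thesis
      using p by (metis dvd_diff_nat nat_dvd_1_iff_1 not_prime_1)
  qed
  have "multiplicity p (order (SL2 :: ('a^2^2) monoid)) = e"
    using p ndvd unfolding order_SL2 q
    by (intro multiplicity_decomposeI) (auto simp: mult.commute q)
  then have syl: "sylow_subgroups p SL2 = {T :: ('a^2^2) set. subgroup T SL2 \<and> card T = CARD('a)}"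
    by (simp add: sylow_subgroups_def q)
  have "T \<in> fixer ` (- {0 :: 'a^2})" if T: "subgroup T SL2" "card T = CARD('a)" for T :: "('a^2^2) set"
  proof -
    interpret group_action "SL2\<lparr>carrier := T\<rparr>" "- {0 :: 'a^2}" SL2_act
      using group_action.induced_action[OF SL2_action T(1)] .
    have "\<exists>v\<in>- {0 :: 'a^2}. \<forall>g\<in>carrier (SL2\<lparr>carrier := T\<rparr>). SL2_act g v = v"
      using p T(2) ndvd
      by (intro p_group_fixed_point[of p e]) (simp_all add: order_def q card_nonzero_vectors)
    then obtain v :: "'a^2" where v: "v \<noteq> 0" "\<forall>g\<in>T. g *v v = v"
      by auto
    then have "T \<subseteq> fixer v"
      using subgroup.subset[OF T(1)] by (auto simp: fixer_def)
    then have "T = fixer v"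
      using T(2) v(1) by (intro card_subset_eq) (simp_all add: card_fixer)
    with v(1) show ?thesis by blast
  qed
  moreover have "fixer v \<in> sylow_subgroups p SL2" if "v \<noteq> 0" for v :: "'a^2"
    using that by (simp add: syl subgroup_fixer card_fixer)
  ultimately show ?thesis
    unfolding syl by blast
qed

section \<open>Generation by two Sylow subgroups\<close>

lemma fixer_scale:
  assumes "c \<noteq> 0"
  shows "fixer (c *s v) = fixer v"
  using assms by (simp add: fixer_def vector_scalar_commute)

text \<open>Elementary matrices generate: with a nonzero lower left entry, \<open>A\<close> is a
  product upper, lower, upper, whose outer parameters are solved from the diagonal of
  \<open>A\<close>. If that entry is zero, adding the first row to the second makes it
  nonzero.\<close>

lemma SL2_elementary_induct:
  fixes A :: "'a::field^2^2"
  assumes "det A = 1"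
    and upper: "\<And>t. Q (mat22 1 t 0 1)" and lower: "\<And>t. Q (mat22 1 0 t 1)"
    and mult: "\<And>A B. Q A \<Longrightarrow> Q B \<Longrightarrow> Q (A ** B)"
  shows "Q A"
proof -
  have nonzero: "Q A" if det: "det A = 1" and c: "A$2$1 \<noteq> 0" for A :: "'a^2^2"
  proof -
    have b: "A$1$2 = (A$1$1 * A$2$2 - 1) / A$2$1"
      using det c by (simp add: det_2 field_simps)
    have "A = mat22 1 ((A$1$1 - 1) / A$2$1) 0 1 ** (mat22 1 0 (A$2$1) 1 ** mat22 1 ((A$2$2 - 1) / A$2$1) 0 1)"
      using c by (simp add: matrix22_eq_iff matrix22_mult_nth b) (simp add: field_simps)
    then show ?thesis
      using upper lower mult by metis
  qed
  show ?thesis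
  proof (cases "A$2$1 = 0")
    case True
    let ?B = "mat22 1 0 1 1 ** A"
    have "A$1$1 \<noteq> 0"
      using True assms(1) by (auto simp: det_2)
    then have "Q ?B"
      using True assms(1) by (intro nonzero) (simp_all add: det_mul matrix22_mult_nth, simp add: det_2)
    moreover have "A = mat22 1 0 (- 1) 1 ** ?B"
      by (simp add: matrix22_eq_iff matrix22_mult_nth)
    ultimately show ?thesis
      using lower mult by metis
  qed (use nonzero assms(1) in blast)
qed

text \<open>In a basis formed by \<open>v\<close> and a multiple of \<open>w\<close>, the two
  stabilizers contain all upper and all lower elementary matrices.\<close>

lemma two_fixers_generate_SL2:
  fixes v w :: "'a::{field,finite}^2"
  assumes H: "subgroup H SL2" and nz: "v \<noteq> 0" "w \<noteq> 0" and neq: "fixer v \<noteq> fixer w"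
    and sub: "fixer v \<subseteq> H" "fixer w \<subseteq> H"
  shows "H = carrier SL2"
proof -
  \<comment> \<open>The determinant with columns \<open>v\<close> and \<open>w\<close>; it vanishes
    only for proportional vectors, and these have the same stabilizer.\<close>
  define c where "c = v$1 * w$2 - v$2 * w$1"
  have "c \<noteq> 0"
  proof
    assume c: "c = 0"
    have "\<exists>k. k \<noteq> 0 \<and> w = k *s v"
    proof (cases "v$1 = 0")
      case True
      then show ?thesis
        using nz c by (intro exI[of _ "w$2 / v$2"]) (auto simp: c_def vec2_eq_iff)
    next
      case False
      then show ?thesis
        using nz c by (intro exI[of _ "w$1 / v$1"]) (auto simp: c_def vec2_eq_iff field_simps)
    qed
    then show False
      using neq fixer_scale by metis
  qed
  \<comment> \<open>Dividing the second column by \<open>c\<close> gives determinant 1 and leaves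
    the stabilizer of that column unchanged.\<close>
  define g where "g = mat22 (v$1) (w$1 / c) (v$2) (w$2 / c)"
  have g: "det g = 1"
    using \<open>c \<noteq> 0\<close> by (simp add: g_def det_2 diff_divide_distrib[symmetric] c_def mult.commute)
  note gi = SL2_inv[OF g] SL2_inv_vector[OF g]
  let ?e1 = "axis 1 1 :: 'a^2" and ?e2 = "axis 2 1 :: 'a^2"
  have ge: "g *v ?e1 = v" "g *v ?e2 = (1 / c) *s w"
    by (simp_all add: g_def vec2_eq_iff matrix22_vector_nth axis_def)
  have conj: "g ** B ** inv\<^bsub>SL2\<^esub> g \<in> fixer (g *v x)" if "B \<in> fixer x" for B x
    using that g gi by (simp add: fixer_def det_mul matrix_vector_mul_assoc[symmetric])
  have "g ** B ** inv\<^bsub>SL2\<^esub> g \<in> H" if "det B = 1" for B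
  proof (rule SL2_elementary_induct[OF that])
    fix t :: 'a
    have "mat22 1 t 0 1 \<in> fixer ?e1" "mat22 1 0 t 1 \<in> fixer ?e2"
      by (simp_all add: fixer_def det_2 vec2_eq_iff matrix22_vector_nth axis_def)
    then show "g ** mat22 1 t 0 1 ** inv\<^bsub>SL2\<^esub> g \<in> H" "g ** mat22 1 0 t 1 ** inv\<^bsub>SL2\<^esub> g \<in> H"
      using conj ge sub fixer_scale[of "1 / c" w] \<open>c \<noteq> 0\<close> by fastforce+
  next
    fix A B assume AB: "g ** A ** inv\<^bsub>SL2\<^esub> g \<in> H" "g ** B ** inv\<^bsub>SL2\<^esub> g \<in> H"
    have "g ** (A ** B) ** inv\<^bsub>SL2\<^esub> g = g ** A ** (inv\<^bsub>SL2\<^esub> g ** g) ** B ** inv\<^bsub>SL2\<^esub> g"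
      using gi by (simp add: matrix_mul_assoc)
    also have "\<dots> = (g ** A ** inv\<^bsub>SL2\<^esub> g) ** (g ** B ** inv\<^bsub>SL2\<^esub> g)"
      by (simp add: matrix_mul_assoc)
    finally show "g ** (A ** B) ** inv\<^bsub>SL2\<^esub> g \<in> H"
      using subgroup.m_closed[OF H AB] by simp
  qed
  \<comment> \<open>Conjugation by \<open>g\<close> is onto, so the elements found in
    \<open>H\<close> exhaust the group.\<close>
  moreover have "A = g ** (inv\<^bsub>SL2\<^esub> g ** A ** g) ** inv\<^bsub>SL2\<^esub> g" for A
  proof -
    have "g ** (inv\<^bsub>SL2\<^esub> g ** A ** g) ** inv\<^bsub>SL2\<^esub> g = (g ** inv\<^bsub>SL2\<^esub> g) ** A ** (g ** inv\<^bsub>SL2\<^esub> g)"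
      by (simp add: matrix_mul_assoc)
    then show ?thesis
      using gi by simp
  qed
  moreover have "det (inv\<^bsub>SL2\<^esub> g ** A ** g) = 1" if "det A = 1" for A
    using that g gi by (simp add: det_mul)
  ultimately have "carrier SL2 \<subseteq> H"
    by (metis SL2_simps(1) subsetI)
  then show ?thesis
    using subgroup.subset[OF H] by blast
qed

section \<open>Parallelisms\<close>

lemma short_blocks_SL2_incidence:
  "short_blocks p (SL2_incidence p S \<D>)
    = {T #>\<^bsub>SL2\<^esub> g | T g. T \<in> sylow_subgroups p SL2 \<and> g \<in> carrier SL2}"
  unfolding short_blocks_def SL2_incidence_def snd_conv by blast

text \<open>A count: \<open>q^2 - 1\<close> pairwise disjoint blocks of q points have as many points
  as the group has elements.\<close>

lemma Union_parallel_class: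
  fixes S :: "('a::{field,finite}^2^2) set"
  assumes p: "prime p" and q: "CARD('a) = p ^ e"
    and par: "parallelism p (SL2_incidence p S \<D>) \<pi>" and C: "C \<in> \<pi>"
  shows "\<Union> C = carrier SL2"
proof (rule card_subset_eq)
  have C_sub: "C \<subseteq> {T #>\<^bsub>SL2\<^esub> g | T g. T \<in> sylow_subgroups p SL2 \<and> g \<in> carrier SL2}"
    using par C unfolding parallelism_def short_blocks_SL2_incidence partition_on_def by blast
  have block: "card B = CARD('a) \<and> B \<subseteq> carrier SL2" if B: "B \<in> C" for B
  proof -
    obtain T g where T: "T \<in> sylow_subgroups p SL2" "g \<in> carrier SL2" "B = T #>\<^bsub>SL2\<^esub> g"
      using subsetD[OF C_sub B] by blast
    then obtain v :: "'a^2" where "v \<noteq> 0" "T = fixer v"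
      using sylow_subgroups_SL2[OF p q] by blast
    with T have B: "v \<noteq> 0" "g \<in> carrier SL2" "B = fixer v #>\<^bsub>SL2\<^esub> g"
      by simp_all
    note v_sub = subgroup.subset[OF subgroup_fixer[of v]]
    have "B \<in> rcosets\<^bsub>SL2\<^esub> fixer v"
      unfolding B(3) using SL2.rcosetsI[OF v_sub B(2)] .
    then have "card B = CARD('a)"
      using SL2.card_rcosets_equal[OF _ v_sub] card_fixer[OF B(1)] by metis
    moreover have "B \<subseteq> carrier SL2"
      unfolding B(3) using SL2.r_coset_subset_G[OF v_sub B(2)] .
    ultimately show ?thesis by blast
  qed
  have "card C = CARD('a)\<^sup>2 - 1" "pairwise disjnt C"
    using par C by (auto simp: parallelism_def disjoint_def pairwise_def disjnt_def)
  then have "card (\<Union> C) = (CARD('a)\<^sup>2 - 1) * CARD('a)"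
    using block by (subst card_Union_disjoint) auto
  then show "card (\<Union> C) = card (carrier (SL2 :: ('a^2^2) monoid))"
    using order_SL2[where 'a = 'a] by (simp add: order_def)
  show "\<Union> C \<subseteq> carrier SL2"
    using block by blast
qed simp

theorem mainTheorem5:
  fixes p e :: nat
    and S :: "('a::{field,finite}^2^2) set"
    and \<D> :: "('a^2^2) set set"
    and \<pi> :: "('a^2^2) set set set"
  assumes "prime p" and "CARD('a) = p ^ e"
    and "affine_SL2_unital p S \<D>"
    and "parallelism p (SL2_incidence p S \<D>) \<pi>"
    and "\<And>h C. h \<in> carrier SL2 \<Longrightarrow> C \<in> \<pi> \<Longrightarrow>
           (\<lambda>B. (\<lambda>x. x \<otimes>\<^bsub>SL2\<^esub> h) ` B) ` C \<in> \<pi>"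
  shows "\<pi> \<in> {flat_parallelism p, natural_parallelism p}"
proof -
  note sylow = sylow_subgroups_SL2[OF assms(1,2)]
  \<comment> \<open>The abstract hypotheses on \<open>P\<close> are verified by writing every Sylow
    subgroup as the stabilizer of a nonzero vector.\<close>
  interpret invariant_coset_partition SL2 "sylow_subgroups p (SL2 :: ('a^2^2) monoid)" \<pi>
  proof (intro invariant_coset_partition.intro invariant_coset_partition_axioms.intro group_SL2)
    show "finite (carrier (SL2 :: ('a^2^2) monoid))" by simp
    show "subgroup T SL2" if "T \<in> sylow_subgroups p SL2" for T :: "('a^2^2) set"
      using that by (simp add: sylow_subgroups_def)
    show "inv\<^bsub>SL2\<^esub> h <#\<^bsub>SL2\<^esub> T #>\<^bsub>SL2\<^esub> h \<in> sylow_subgroups p SL2"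
      if "T \<in> sylow_subgroups p SL2" "h \<in> carrier SL2" for T and h :: "'a^2^2"
      using that SL2_inv(1)[of h] unfolding sylow by (auto simp: conjugate_fixer SL2_vector_eq_0_iff intro!: imageI)
    show "\<exists>h\<in>carrier SL2. T' = inv\<^bsub>SL2\<^esub> h <#\<^bsub>SL2\<^esub> T #>\<^bsub>SL2\<^esub> h"
      if T: "T \<in> sylow_subgroups p SL2" "T' \<in> sylow_subgroups p SL2" for T T' :: "('a^2^2) set"
    proof -
      obtain v w where v: "v \<noteq> 0" "T = fixer v" and w: "w \<noteq> 0" "T' = fixer w"
        using T unfolding sylow by blast
      \<comment> \<open>Conjugating by \<open>h\<close> replaces the fixed vector \<open>v\<close>
        by its image under the inverse of \<open>h\<close>, so \<open>h\<close> has to carry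
        \<open>w\<close> to \<open>v\<close>.\<close>
      obtain h where "det h = 1" "h *v w = v"
        using SL2_transitive[OF w(1) v(1)] .
      then show ?thesis
        using v w SL2_inv_vector(2)[of h w] by (intro bexI[of _ h]) (simp_all add: conjugate_fixer)
    qed
    show "H = carrier SL2"
      if "subgroup H SL2" "T \<in> sylow_subgroups p SL2" "T' \<in> sylow_subgroups p SL2" "T \<noteq> T'"
        "T \<subseteq> H" "T' \<subseteq> H" for H T T' :: "('a^2^2) set"
      using that two_fixers_generate_SL2 unfolding sylow by blast
    show "partition_on {T #>\<^bsub>SL2\<^esub> g | T g. T \<in> sylow_subgroups p SL2 \<and> g \<in> carrier SL2} \<pi>"
      using assms(4) unfolding parallelism_def short_blocks_SL2_incidence by blast
    show "disjoint C" if "C \<in> \<pi>" for C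
      using assms(4) that by (simp add: parallelism_def)
    show "\<Union> C = carrier SL2" if "C \<in> \<pi>" for C
      using Union_parallel_class[OF assms(1,2,4) that] .
    show "(\<lambda>B. B #>\<^bsub>SL2\<^esub> h) ` C \<in> \<pi>" if "C \<in> \<pi>" "h \<in> carrier SL2" for C h
    proof -
      have "B #>\<^bsub>SL2\<^esub> h = (\<lambda>x. x \<otimes>\<^bsub>SL2\<^esub> h) ` B" for B
        by (auto simp: r_coset_def)
      then show ?thesis
        using assms(5)[OF that(2,1)] by simp
    qed
  qed
  show ?thesis
    using right_or_left_cosets
    by (simp add: flat_parallelism_def natural_parallelism_def Setcompr_eq_image)
qed

end
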